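(* For any $n\ge2$, $\mathbf{m}$ with $m_i\ge 2$, and any $t\in\mathbb{N}$, $$\left\lfloor\frac{t}{n}\right\rfloor\frac{1}{q_{n,\mathbf{m}}}\left(1-\frac{\left(\left\lceil\frac{t}{n}\right\rceil\right)^2}{2}\frac{n}{q_{n,\mathbf{m}}}\right)\le\Pr\left[H\le t\right]\le\frac{t}{q_{n,\mathbf{m}}},$$ where $H=\inf\{\tau\ge 1:\mathbf{A}^\tau \text{ is a PNE of } G_{n,\mathbf{m}}\}$ is the hitting time of the set of PNE by the clockwork best-response dynamic.
   Context: A random game $G_{n,\mathbf{m}}$ has $n\ge 2$ players; player $i$ has action set $[m_i]=\{1,\dots,m_i\}$, $m_i\ge2$; $\mathcal{M}=\times_i[m_i]$. Payoffs $U_i(\mathbf{a})$ are drawn from a fixed atomless distribution on $\mathbb{R}$, independently across $i$ and $\mathbf{a}\in\mathcal{M}$. The best response $B_i(\mathbf{a}_{-i})=\arg\max_{x\in[m_i]}U_i(x,\mathbf{a}_{-i})$ is a.s. unique; a PNE is a profile $\mathbf{a}$ with $a_i=B_i(\mathbf{a}_{-i})$ for all $i$. The clockwork sequence is $s_{\texttt{c}}(t)=1+((t-1)\bmod n)$. The clockwork best-response dynamic: $\mathbf{A}^0$ uniform on $\mathcal{M}$ independent of payoffs; for $t\ge1$ with $i=s_{\texttt{c}}(t)$, $A^t_j=A^{t-1}_j$ ($j\ne i$) and $A^t_i=B_i(\mathbf{A}^{t-1}_{-i})$. $q_{n,\mathbf{m}}=\prod_i m_i/\max_i m_i$. $\inf\emptyset=\infty$.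 *)

theory Defs
  imports "HOL-Probability.Probability"
begin

definition profiles :: "nat \<Rightarrow> (nat \<Rightarrow> nat) \<Rightarrow> (nat \<Rightarrow> nat) set" where
  "profiles n m = PiE {..<n} (\<lambda>i. {..<m i})"

definition payoff_index :: "nat \<Rightarrow> (nat \<Rightarrow> nat) \<Rightarrow> (nat \<times> (nat \<Rightarrow> nat)) set" where
  "payoff_index n m = {..<n} \<times> profiles n m"

text \<open>Best response of player i to the profile a (only a_{-i} matters);
  ties (a null event) are broken towards the smallest action.\<close>
definition best_response ::
  "(nat \<Rightarrow> nat) \<Rightarrow> (nat \<times> (nat \<Rightarrow> nat) \<Rightarrow> real) \<Rightarrow> nat \<Rightarrow> (nat \<Rightarrow> nat) \<Rightarrow> nat" where
  "best_response m U i a =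
     (LEAST x. x < m i \<and> (\<forall>y < m i. U (i, a(i := y)) \<le> U (i, a(i := x))))"

definition is_PNE ::
  "nat \<Rightarrow> (nat \<Rightarrow> nat) \<Rightarrow> (nat \<times> (nat \<Rightarrow> nat) \<Rightarrow> real) \<Rightarrow> (nat \<Rightarrow> nat) \<Rightarrow> bool" where
  "is_PNE n m U a \<longleftrightarrow> a \<in> profiles n m \<and> (\<forall>i<n. a i = best_response m U i a)"

text \<open>Clockwork dynamic: at step t+1 the player (t mod n) (0-indexed version of
  1 + ((t+1)-1) mod n) best-responds.\<close>
fun clockwork ::
  "nat \<Rightarrow> (nat \<Rightarrow> nat) \<Rightarrow> (nat \<times> (nat \<Rightarrow> nat) \<Rightarrow> real) \<Rightarrow> (nat \<Rightarrow> nat) \<Rightarrow> nat \<Rightarrow> (nat \<Rightarrow> nat)" where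
  "clockwork n m U a0 0 = a0"
| "clockwork n m U a0 (Suc t) =
     (let a = clockwork n m U a0 t; i = t mod n in a(i := best_response m U i a))"

text \<open>Hitting time H = inf {tau >= 1. A^tau is a PNE}, with inf of the empty set = infinity.\<close>
definition hitting_time ::
  "nat \<Rightarrow> (nat \<Rightarrow> nat) \<Rightarrow> (nat \<times> (nat \<Rightarrow> nat) \<Rightarrow> real) \<Rightarrow> (nat \<Rightarrow> nat) \<Rightarrow> enat" where
  "hitting_time n m U a0 =
     Inf {enat tau | tau. tau \<ge> 1 \<and> is_PNE n m U (clockwork n m U a0 tau)}"

definition q_nm :: "nat \<Rightarrow> (nat \<Rightarrow> nat) \<Rightarrow> real" where
  "q_nm n m = real (\<Prod>i<n. m i) / real (Max (m ` {..<n}))"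

definition game_space ::
  "nat \<Rightarrow> (nat \<Rightarrow> nat) \<Rightarrow> real measure \<Rightarrow> ((nat \<times> (nat \<Rightarrow> nat) \<Rightarrow> real) \<times> (nat \<Rightarrow> nat)) measure" where
  "game_space n m D =
     PiM (payoff_index n m) (\<lambda>_. D) \<Otimes>\<^sub>M measure_pmf (pmf_of_set (profiles n m))"

end

theory Submission
  imports Defs
begin

text \<open>
  Almost surely there are no ties, and permuting the actions of a player at a fixed profile of the
  others preserves the payoff distribution, so the table of best responses is uniform among all
  tables. The dynamic started at a fixed profile queries this table adaptively, and entries not
  yet queried are uniform given the history.

  Upper bound: if \<open>H = \<tau>\<close>, none of the entries that decide whether \<open>A\<^sup>\<tau>\<close> is an equilibrium, except
  the mover's, has been queried (otherwise \<open>A\<^sup>\<tau>\<close> would have been visited before), so the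
  conditional probability of an equilibrium at \<open>\<tau>\<close> is at most \<open>1 / q\<close>.

  Lower bound: let \<open>i\<close> have the most actions and consider only the times \<open>\<tau>\<close> just after a move of \<open>i\<close>.
  If no query was repeated so far and \<open>A\<^sup>\<tau>\<close> needs no entry queried more than one round ago, then
  the entries queried within the last round already agree with \<open>A\<^sup>\<tau>\<close> and the unqueried ones
  agree with probability at least \<open>1 / q\<close>. The resulting events are disjoint for different \<open>\<tau>\<close>.
  Each possible collision has probability at most \<open>1 / q\<close>, because \<open>n\<close> consecutive fresh moves make
  all coordinates uniform; in round \<open>r\<close> (counted from 0) there are at most \<open>n r (r + 3) / 2\<close>
  possible collisions, and \<open>\<Sum>r<k. r (r + 3) \<le> k\<^sup>3\<close>.
\<close>

section \<open>Adaptive queries to a uniform table\<close>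

text \<open>Deferred decisions: \<open>Q \<omega>\<close> is a set of entries whose values do not influence membership in
  \<open>E\<close>, the set \<open>Q\<close> itself or the prescribed values \<open>v\<close>; they are then independent of \<open>E\<close>.\<close>

lemma card_deferred_decisions:
  fixes E :: "('c \<Rightarrow> 'v) set"
  assumes finC: "finite C" and finR: "\<And>c. c \<in> C \<Longrightarrow> finite (R c)"
    and E: "E \<subseteq> PiE C R"
    and Q: "\<And>\<omega>. \<omega> \<in> E \<Longrightarrow> Q \<omega> \<subseteq> C"
    and v: "\<And>\<omega> c. \<omega> \<in> E \<Longrightarrow> c \<in> Q \<omega> \<Longrightarrow> v \<omega> c \<in> R c"
    and inv: "\<And>\<omega> \<omega>'. \<omega> \<in> E \<Longrightarrow> \<omega>' \<in> PiE C R \<Longrightarrow> (\<And>c. c \<in> C \<Longrightarrow> c \<notin> Q \<omega> \<Longrightarrow> \<omega>' c = \<omega> c)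
      \<Longrightarrow> \<omega>' \<in> E \<and> Q \<omega>' = Q \<omega> \<and> v \<omega>' = v \<omega>"
  shows "card E = (\<Sum>\<omega> | \<omega> \<in> E \<and> (\<forall>c\<in>Q \<omega>. \<omega> c = v \<omega> c). \<Prod>c\<in>Q \<omega>. card (R c))"
proof -
  let ?G = "{\<omega>. \<omega> \<in> E \<and> (\<forall>c\<in>Q \<omega>. \<omega> c = v \<omega> c)}"
  \<comment> \<open>\<open>\<phi>\<close> fills the deferred entries with the prescribed values. It
    retracts \<open>E\<close> to \<open>?G\<close>, and the fibre over \<open>\<omega>\<close>
    consists of all free choices of the entries in \<open>Q \<omega>\<close>, so counting
    \<open>E\<close> by fibres gives the sum.\<close>
  define \<phi> where "\<phi> \<omega> = (\<lambda>c. if c \<in> Q \<omega> then v \<omega> c else \<omega> c)" for \<omega>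
  have finE: "finite E"
    using E finite_PiE[OF finC, of R] finR by (blast intro: finite_subset)
  have \<phi>: "\<phi> \<omega> \<in> E" "Q (\<phi> \<omega>) = Q \<omega>" "v (\<phi> \<omega>) = v \<omega>" if "\<omega> \<in> E" for \<omega>
  proof -
    have "\<phi> \<omega> \<in> PiE C R"
      using that E Q[OF that] v[OF that] unfolding \<phi>_def PiE_iff extensional_def by (auto split: if_splits)
    then show "\<phi> \<omega> \<in> E" "Q (\<phi> \<omega>) = Q \<omega>" "v (\<phi> \<omega>) = v \<omega>"
      using inv[OF that, of "\<phi> \<omega>"] by (auto simp: \<phi>_def)
  qed
  have \<phi>G: "\<phi> ` E \<subseteq> ?G"
    using \<phi> by (auto simp: \<phi>_def)
  have fibre: "card {x\<in>E. \<phi> x = \<omega>} = (\<Prod>c\<in>Q \<omega>. card (R c))" if "\<omega> \<in> ?G" for \<omega>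
  proof -
    have \<omega>: "\<omega> \<in> E" "\<And>c. c \<in> Q \<omega> \<Longrightarrow> \<omega> c = v \<omega> c" using that by auto
    have "bij_betw (\<lambda>x. restrict x (Q \<omega>)) {x\<in>E. \<phi> x = \<omega>} (PiE (Q \<omega>) R)"
    proof (rule bij_betw_byWitness[where f' = "\<lambda>y c. if c \<in> Q \<omega> then y c else \<omega> c"])
      show "\<forall>x\<in>{x\<in>E. \<phi> x = \<omega>}. (\<lambda>c. if c \<in> Q \<omega> then restrict x (Q \<omega>) c else \<omega> c) = x"
      proof
        fix x assume "x \<in> {x\<in>E. \<phi> x = \<omega>}"
        then have x: "x \<in> E" "\<phi> x = \<omega>" by auto
        then have "Q x = Q \<omega>" using \<phi>(2) by metis
        then have "\<omega> c = x c" if "c \<notin> Q \<omega>" for c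
          using that fun_cong[OF x(2), of c] by (simp add: \<phi>_def)
        then show "(\<lambda>c. if c \<in> Q \<omega> then restrict x (Q \<omega>) c else \<omega> c) = x"
          by auto
      qed
      show "\<forall>y\<in>PiE (Q \<omega>) R. restrict (\<lambda>c. if c \<in> Q \<omega> then y c else \<omega> c) (Q \<omega>) = y"
        by (auto simp: PiE_iff extensional_def)
      show "(\<lambda>x. restrict x (Q \<omega>)) ` {x\<in>E. \<phi> x = \<omega>} \<subseteq> PiE (Q \<omega>) R"
        using E Q[OF \<omega>(1)] by (auto simp: PiE_iff subset_iff)
      show "(\<lambda>y c. if c \<in> Q \<omega> then y c else \<omega> c) ` PiE (Q \<omega>) R \<subseteq> {x\<in>E. \<phi> x = \<omega>}"
      proof clarify
        fix y assume y: "y \<in> PiE (Q \<omega>) R"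
        let ?y = "\<lambda>c. if c \<in> Q \<omega> then y c else \<omega> c"
        have "?y \<in> PiE C R"
          using y E \<omega>(1) Q[OF \<omega>(1)] by (auto simp: PiE_iff extensional_def subset_iff)
        then have "?y \<in> E \<and> Q ?y = Q \<omega> \<and> v ?y = v \<omega>"
          by (intro inv[OF \<omega>(1)]) auto
        then show "?y \<in> E \<and> \<phi> ?y = \<omega>"
          using \<omega>(2) by (auto simp: \<phi>_def)
      qed
    qed
    then show ?thesis
      using finite_subset[OF Q[OF \<omega>(1)] finC] by (simp add: bij_betw_same_card card_PiE)
  qed
  have "card E = (\<Sum>x\<in>E. 1)" by simp
  also have "\<dots> = (\<Sum>\<omega>\<in>?G. \<Sum>x\<in>{x\<in>E. \<phi> x = \<omega>}. 1)"
    using finE \<phi>G by (intro sum.group[symmetric]) auto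
  also have "\<dots> = (\<Sum>\<omega>\<in>?G. \<Prod>c\<in>Q \<omega>. card (R c))"
    using fibre by (intro sum.cong) auto
  finally show ?thesis .
qed

section \<open>Best-response tables and the deterministic dynamic they drive\<close>

locale clockwork_game =
  fixes n :: nat and m :: "nat \<Rightarrow> nat"
  assumes n_pos: "0 < n" and m_pos: "\<And>i. i < n \<Longrightarrow> 0 < m i"
begin

text \<open>\<open>a\<^bsub>-i\<^esub>\<close> is encoded as the profile whose \<open>i\<close>-th coordinate is reset to 0.\<close>

definition ctx :: "nat \<Rightarrow> (nat \<Rightarrow> nat) \<Rightarrow> nat \<times> (nat \<Rightarrow> nat)" where
  "ctx i a = (i, a(i := 0))"

definition contexts :: "(nat \<times> (nat \<Rightarrow> nat)) set" where
  "contexts = {(i, a). i < n \<and> a \<in> profiles n m \<and> a i = 0}"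

definition responses :: "(nat \<times> (nat \<Rightarrow> nat) \<Rightarrow> nat) set" where
  "responses = PiE contexts (\<lambda>c. {..<m (fst c)})"

text \<open>The recursion of \<open>clockwork\<close>, but reading a fixed table instead of payoffs,
  so that probabilities become counts over the finite set \<open>responses\<close>.\<close>

primrec state :: "(nat \<times> (nat \<Rightarrow> nat) \<Rightarrow> nat) \<Rightarrow> (nat \<Rightarrow> nat) \<Rightarrow> nat \<Rightarrow> nat \<Rightarrow> nat" where
  "state b a 0 = a"
| "state b a (Suc t) = (state b a t)(t mod n := b (ctx (t mod n) (state b a t)))"

definition query :: "(nat \<times> (nat \<Rightarrow> nat) \<Rightarrow> nat) \<Rightarrow> (nat \<Rightarrow> nat) \<Rightarrow> nat \<Rightarrow> nat \<times> (nat \<Rightarrow> nat)" where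
  "query b a t = ctx (t mod n) (state b a t)"

definition fresh :: "(nat \<times> (nat \<Rightarrow> nat) \<Rightarrow> nat) \<Rightarrow> (nat \<Rightarrow> nat) \<Rightarrow> nat \<Rightarrow> bool" where
  "fresh b a t \<longleftrightarrow> inj_on (query b a) {..<t}"

definition nash :: "(nat \<times> (nat \<Rightarrow> nat) \<Rightarrow> nat) \<Rightarrow> (nat \<Rightarrow> nat) \<Rightarrow> bool" where
  "nash b a \<longleftrightarrow> (\<forall>i<n. b (ctx i a) = a i)"

abbreviation agree_off :: "nat \<Rightarrow> (nat \<Rightarrow> nat) \<Rightarrow> (nat \<Rightarrow> nat) \<Rightarrow> bool" where
  "agree_off j a a' \<equiv> (\<forall>k<n. k \<noteq> j \<longrightarrow> a k = a' k)"

lemma ctx_eq_iff: "ctx i a = ctx j a' \<longleftrightarrow> i = j \<and> (\<forall>k. k \<noteq> i \<longrightarrow> a k = a' k)"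
  by (auto simp: ctx_def fun_eq_iff split: if_splits)

lemma fst_ctx [simp]: "fst (ctx i a) = i"
  by (simp add: ctx_def)

lemma finite_profiles: "finite (profiles n m)"
  by (simp add: profiles_def finite_PiE)

lemma finite_contexts: "finite contexts"
  by (rule finite_subset[of _ "{..<n} \<times> profiles n m"]) (auto simp: contexts_def finite_profiles)

lemma finite_responses: "finite responses"
  by (simp add: responses_def finite_PiE finite_contexts)

lemma upd_profile: "a \<in> profiles n m \<Longrightarrow> i < n \<Longrightarrow> x < m i \<Longrightarrow> a(i := x) \<in> profiles n m"
  by (auto simp: profiles_def PiE_iff extensional_def)

lemma ctx_in_contexts: "a \<in> profiles n m \<Longrightarrow> i < n \<Longrightarrow> ctx i a \<in> contexts"
  by (simp add: contexts_def ctx_def upd_profile m_pos)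

lemma response_less: "b \<in> responses \<Longrightarrow> a \<in> profiles n m \<Longrightarrow> i < n \<Longrightarrow> b (ctx i a) < m i"
  using ctx_in_contexts[of a i] by (force simp: responses_def PiE_iff)

lemma state_in_profiles:
  "b \<in> responses \<Longrightarrow> a \<in> profiles n m \<Longrightarrow> state b a t \<in> profiles n m"
  by (induction t) (simp_all add: upd_profile response_less n_pos)

lemma query_in_contexts:
  "b \<in> responses \<Longrightarrow> a \<in> profiles n m \<Longrightarrow> query b a t \<in> contexts"
  by (simp add: query_def ctx_in_contexts state_in_profiles n_pos)

lemma state_less: "b \<in> responses \<Longrightarrow> a \<in> profiles n m \<Longrightarrow> k < n \<Longrightarrow> state b a t k < m k"
  using state_in_profiles[of b a t] by (auto simp: profiles_def PiE_iff)

text \<open>A run depends only on the entries it reads, and the hypothesis concerns just those read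
  along the trajectory of \<open>b\<close>. This supplies the invariance required for deferring
  unread entries.\<close>

lemma state_cong:
  assumes "\<And>u. u < t \<Longrightarrow> b' (query b a u) = b (query b a u)" "u \<le> t"
  shows "state b' a u = state b a u"
  using assms(2)
proof (induction u)
  case (Suc u)
  then show ?case using assms(1)[of u] by (simp add: query_def)
qed simp

lemma query_cong:
  assumes "\<And>u. u < t \<Longrightarrow> b' (query b a u) = b (query b a u)" "u \<le> t"
  shows "query b' a u = query b a u"
  using state_cong[of t b' b a u] assms by (simp add: query_def)

lemma state_coord_stable:
  assumes "s \<le> t" "\<And>u. s \<le> u \<Longrightarrow> u < t \<Longrightarrow> u mod n \<noteq> k"
  shows "state b a t k = state b a s k"
  using assms
proof (induction t rule: dec_induct)
  case (step t)
  then show ?case by (metis fun_upd_other less_Suc_eq lessI state.simps(2))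
qed simp

lemma mod_eq_imp_add_le:
  assumes "s < t" "s mod n = t mod n"
  shows "s + n \<le> t"
proof -
  have "n dvd t - s" using assms mod_eq_dvd_iff_nat[of s t n] by simp
  then have "n \<le> t - s" using assms(1) by (simp add: dvd_imp_le)
  then show ?thesis using assms(1) by simp
qed

text \<open>At an equilibrium each response read is the action already played, so no move changes
  the profile.\<close>

lemma nash_persists:
  assumes "nash b (state b a s)" "s \<le> t"
  shows "state b a t = state b a s"
  using assms(2)
proof (induction t rule: dec_induct)
  case (step t)
  then show ?case using assms(1) n_pos by (simp add: nash_def)
qed simp

section \<open>Equilibria reached for the first time\<close>

text \<open>The entries deciding the conditions of all players but the mover are still unread when
  the equilibrium is new. They can be deferred, and exactly one of their joint values is compatible
  with an equilibrium.\<close>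

lemma card_first_nash:
  assumes a: "a \<in> profiles n m"
  shows "card {b \<in> responses. nash b (state b a (Suc t)) \<and> (\<forall>s\<in>{1..t}. \<not> nash b (state b a s))}
    * (\<Prod>k\<in>{..<n} - {t mod n}. m k) \<le> card responses"
proof -
  let ?J = "{..<n} - {t mod n}"
  define Q where "Q b = (\<lambda>j. ctx j (state b a (Suc t))) ` ?J" for b
  define v where "v b c = state b a (Suc t) (fst c)" for b and c :: "nat \<times> (nat \<Rightarrow> nat)"
  define E where "E = {b \<in> responses. \<forall>u\<le>t. query b a u \<notin> Q b}"
  let ?G = "{b. b \<in> E \<and> (\<forall>c\<in>Q b. b c = v b c)}"
  have E: "card E = (\<Sum>b\<in>?G. \<Prod>c\<in>Q b. card {..<m (fst c)})"
  proof (rule card_deferred_decisions[OF finite_contexts])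
    show "E \<subseteq> PiE contexts (\<lambda>c. {..<m (fst c)})" by (auto simp: E_def responses_def)
    show "Q b \<subseteq> contexts" if "b \<in> E" for b
      using that a by (auto simp: E_def Q_def ctx_in_contexts state_in_profiles simp del: state.simps)
    show "v b c \<in> {..<m (fst c)}" if "b \<in> E" "c \<in> Q b" for b c
      using that a by (auto simp: E_def Q_def v_def state_less simp del: state.simps)
  next
    fix b b' assume b: "b \<in> E" and b': "b' \<in> PiE contexts (\<lambda>c. {..<m (fst c)})"
      and eq: "\<And>c. c \<in> contexts \<Longrightarrow> c \<notin> Q b \<Longrightarrow> b' c = b c"
    have *: "b' (query b a u) = b (query b a u)" if "u < Suc t" for u
      using b that a by (intro eq) (auto simp: E_def query_in_contexts)
    have st: "state b' a u = state b a u" if "u \<le> Suc t" for u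
      by (rule state_cong[OF _ that]) (rule *)
    have qu: "query b' a u = query b a u" if "u \<le> Suc t" for u
      by (rule query_cong[OF _ that]) (rule *)
    have "Q b' = Q b" "v b' = v b"
      unfolding Q_def v_def st[OF order_refl] by simp_all
    moreover have "b' \<in> E" using b b' qu \<open>Q b' = Q b\<close> by (auto simp: E_def responses_def)
    ultimately show "b' \<in> E \<and> Q b' = Q b \<and> v b' = v b" by blast
  qed auto
  have prod: "(\<Prod>c\<in>Q b. card {..<m (fst c)}) = (\<Prod>k\<in>?J. m k)" for b
    unfolding Q_def by (subst prod.reindex) (auto simp: inj_on_def ctx_eq_iff)
  have sub: "{b \<in> responses. nash b (state b a (Suc t)) \<and> (\<forall>s\<in>{1..t}. \<not> nash b (state b a s))} \<subseteq> ?G"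
  proof clarify
    fix b assume b: "b \<in> responses" and ne: "nash b (state b a (Suc t))"
      and first: "\<forall>s\<in>{1..t}. \<not> nash b (state b a s)"
    have agree: "\<forall>c\<in>Q b. b c = v b c" using ne by (auto simp: Q_def v_def nash_def simp del: state.simps)
    have "query b a u \<notin> Q b" if "u \<le> t" for u
    proof
      assume "query b a u \<in> Q b"
      then obtain j where j: "j < n" "j \<noteq> t mod n" "query b a u = ctx j (state b a (Suc t))"
        by (auto simp: Q_def simp del: state.simps)
      then have uj: "u mod n = j" and off: "\<And>k. k \<noteq> j \<Longrightarrow> state b a u k = state b a (Suc t) k"
        by (auto simp: query_def ctx_eq_iff simp del: state.simps)
      \<comment> \<open>The move at \<open>u\<close> reads the very entry that certifies
        \<open>j\<close> at time \<open>Suc t\<close>, so the same profile is already reached at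
        \<open>Suc u\<close>. As \<open>j\<close> is not the mover at \<open>t\<close>,
        \<open>u\<close> differs from \<open>t\<close> and \<open>Suc u\<close> lies in
        \<open>{1..t}\<close>.\<close>
      have "state b a (Suc u) k = state b a (Suc t) k" for k
      proof (cases "k = j")
        case True
        have "state b a (Suc u) j = b (query b a u)" using uj by (simp add: query_def)
        also have "\<dots> = state b a (Suc t) j" using ne j by (simp add: nash_def del: state.simps)
        finally show ?thesis using True by simp
      next
        case False
        then show ?thesis using off[of k] uj by (simp del: state.simps(2) add: state.simps(2)[of b a u])
      qed
      then have "state b a (Suc u) = state b a (Suc t)" by blast
      moreover have "u \<noteq> t" using uj j by auto
      ultimately show False using ne first that by (metis Suc_leI atLeastAtMost_iff le_neq_implies_less less_eq_Suc_le One_nat_def zero_less_Suc)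
    qed
    then show "b \<in> E \<and> (\<forall>c\<in>Q b. b c = v b c)" using b agree by (simp add: E_def)
  qed
  have finE: "finite E" using finite_responses by (simp add: E_def)
  have "card {b \<in> responses. nash b (state b a (Suc t)) \<and> (\<forall>s\<in>{1..t}. \<not> nash b (state b a s))} \<le> card ?G"
    using finE by (intro card_mono sub) auto
  then have "card {b \<in> responses. nash b (state b a (Suc t)) \<and> (\<forall>s\<in>{1..t}. \<not> nash b (state b a s))}
    * (\<Prod>k\<in>?J. m k) \<le> card ?G * (\<Prod>k\<in>?J. m k)" by (rule mult_le_mono1)
  also have "\<dots> = card E" unfolding E prod by simp
  also have "\<dots> \<le> card responses" using finite_responses by (intro card_mono) (auto simp: E_def)
  finally show ?thesis .
qed

section \<open>Coincidence of profiles at least one round apart\<close>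

lemma bij_betw_mod_window: "bij_betw (\<lambda>u. u mod n) {w..<w + n} {..<n}"
proof -
  have inj: "inj_on (\<lambda>u. u mod n) {w..<w + n}"
  proof (rule linorder_inj_onI)
    fix x y assume "x < y" "x \<in> {w..<w + n}" "y \<in> {w..<w + n}"
    then show "x mod n \<noteq> y mod n" using mod_eq_imp_add_le[of x y] by auto
  qed auto
  moreover have "(\<lambda>u. u mod n) ` {w..<w + n} = {..<n}"
    using n_pos by (intro card_subset_eq) (auto simp: card_image[OF inj])
  ultimately show ?thesis by (simp add: bij_betw_def)
qed

text \<open>In the \<open>n\<close> moves before \<open>t\<close> every player other than
  \<open>j\<close> moves once, reads a new entry and has to land on its action of time
  \<open>s\<close>. That target is fixed before the window opens because
  \<open>s + n \<le> t\<close>, so each such move contributes a factor \<open>m k\<close>.\<close>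

lemma card_collision:
  assumes a: "a \<in> profiles n m" and st: "s + n \<le> t"
  shows "card {b \<in> responses. fresh b a t \<and> agree_off j (state b a t) (state b a s)}
    * (\<Prod>k\<in>{..<n} - {j}. m k) \<le> card responses"
proof -
  define w where "w = t - n"
  have w: "s \<le> w" "t = w + n" using st by (auto simp: w_def)
  \<comment> \<open>Only the first \<open>d\<close> moves of the window are constrained, and
    freshness is required only up to \<open>w + d\<close>. The bound then grows by one factor at a
    time, except at the move of \<open>j\<close>, which is left free.\<close>
  define X where "X d = {b \<in> responses. fresh b a (w + d) \<and>
    (\<forall>u\<in>{w..<w + d}. u mod n \<noteq> j \<longrightarrow> state b a (Suc u) (u mod n) = state b a s (u mod n))}" for d
  define W where "W d = {u\<in>{w..<w + d}. u mod n \<noteq> j}" for d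
  have finX: "finite (X d)" for d using finite_responses by (simp add: X_def)
  have main: "card (X d) * (\<Prod>u\<in>W d. m (u mod n)) \<le> card responses" for d
  proof (induction d)
    case 0
    then show ?case using card_mono[OF finite_responses, of "X 0"] by (auto simp: W_def X_def)
  next
    case (Suc d)
    have sub: "X (Suc d) \<subseteq> X d"
      by (auto simp: X_def fresh_def elim: inj_on_subset)
    show ?case
    proof (cases "(w + d) mod n = j")
      case True
      then have "W (Suc d) = W d" by (auto simp: W_def less_Suc_eq)
      moreover have "card (X (Suc d)) \<le> card (X d)" using sub finX by (rule card_mono[rotated])
      ultimately show ?thesis using Suc mult_le_mono1 le_trans by metis
    next
      case False
      let ?t = "w + d"
      \<comment> \<open>The entry read at \<open>?t\<close> is required to be new, so its value can
        be deferred. Freshness at \<open>Suc ?t\<close> implies this, which places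
        \<open>X (Suc d)\<close> inside \<open>?G\<close>.\<close>
      define E where "E = {b \<in> X d. query b a ?t \<notin> query b a ` {..<?t}}"
      define Q where "Q b = {query b a ?t}" for b
      define v where "v b c = state b a s (?t mod n)" for b and c :: "nat \<times> (nat \<Rightarrow> nat)"
      let ?G = "{b. b \<in> E \<and> (\<forall>c\<in>Q b. b c = v b c)}"
      have "card E = (\<Sum>b\<in>?G. \<Prod>c\<in>Q b. card {..<m (fst c)})"
      proof (rule card_deferred_decisions[OF finite_contexts])
        show "E \<subseteq> PiE contexts (\<lambda>c. {..<m (fst c)})" by (auto simp: E_def X_def responses_def)
        show "Q b \<subseteq> contexts" if "b \<in> E" for b
          using that a by (auto simp: E_def Q_def X_def query_in_contexts)
        show "v b c \<in> {..<m (fst c)}" if "b \<in> E" "c \<in> Q b" for b c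
          using that a by (auto simp: E_def Q_def X_def v_def state_less query_def n_pos)
      next
        fix b b' assume b: "b \<in> E" and b': "b' \<in> PiE contexts (\<lambda>c. {..<m (fst c)})"
          and eq: "\<And>c. c \<in> contexts \<Longrightarrow> c \<notin> Q b \<Longrightarrow> b' c = b c"
        have *: "b' (query b a u) = b (query b a u)" if "u < ?t" for u
        proof (rule eq)
          show "query b a u \<in> contexts" using b a by (simp add: E_def X_def query_in_contexts)
          have "query b a u \<in> query b a ` {..<?t}" using that by simp
          moreover have "query b a ?t \<notin> query b a ` {..<?t}" using b unfolding E_def by blast
          ultimately have "query b a u \<noteq> query b a ?t" by metis
          then show "query b a u \<notin> Q b" by (simp add: Q_def)
        qed
        have st: "state b' a u = state b a u" if "u \<le> ?t" for u
          by (rule state_cong[OF _ that]) (rule *)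
        have qu: "query b' a u = query b a u" if "u \<le> ?t" for u
          by (rule query_cong[OF _ that]) (rule *)
        have "Q b' = Q b" using qu by (simp add: Q_def)
        moreover have "v b' = v b" using st w(1) by (simp add: v_def fun_eq_iff)
        moreover have "fresh b' a ?t"
          using b qu by (auto simp: E_def X_def fresh_def inj_on_def)
        moreover have "state b' a (Suc u) (u mod n) = state b' a s (u mod n)"
          if "u \<in> {w..<?t}" "u mod n \<noteq> j" for u
        proof -
          have "state b a (Suc u) (u mod n) = state b a s (u mod n)"
            using that b unfolding E_def X_def by blast
          then show ?thesis using st[of "Suc u"] st[of s] w(1) that by (simp del: state.simps)
        qed
        moreover have "query b' a ` {..<?t} = query b a ` {..<?t}"
          using qu by (intro image_cong) auto
        ultimately show "b' \<in> E \<and> Q b' = Q b \<and> v b' = v b"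
          using b b' qu[of ?t] unfolding E_def X_def responses_def by (simp del: state.simps)
      qed auto
      then have E: "card E = card ?G * m (?t mod n)"
        by (simp add: Q_def query_def)
      have "X (Suc d) \<subseteq> ?G"
      proof
        fix b assume b: "b \<in> X (Suc d)"
        then have "query b a ?t \<notin> query b a ` {..<?t}"
          by (auto simp: X_def fresh_def lessThan_Suc inj_on_insert)
        moreover have "state b a (Suc ?t) (?t mod n) = state b a s (?t mod n)"
          using b False unfolding X_def by auto
        ultimately show "b \<in> ?G"
          using sub b by (auto simp: E_def Q_def v_def query_def)
      qed
      then have "card (X (Suc d)) \<le> card ?G"
        using finX by (intro card_mono) (auto simp: E_def)
      then have "card (X (Suc d)) * m (?t mod n) \<le> card E" unfolding E by simp
      also have "\<dots> \<le> card (X d)" using finX by (intro card_mono) (auto simp: E_def)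
      finally have "card (X (Suc d)) * m (?t mod n) * (\<Prod>u\<in>W d. m (u mod n)) \<le> card responses"
        using Suc mult_le_mono1 le_trans by blast
      moreover have "W (Suc d) = insert ?t (W d)" using False by (auto simp: W_def less_Suc_eq)
      moreover have "?t \<notin> W d" "finite (W d)" by (auto simp: W_def)
      ultimately show ?thesis by (simp add: mult.assoc)
    qed
  qed
  have "bij_betw (\<lambda>u. u mod n) (W n) ({..<n} - {j})"
  proof (rule bij_betw_imageI)
    show "inj_on (\<lambda>u. u mod n) (W n)"
      using bij_betw_imp_inj_on[OF bij_betw_mod_window[of w]] by (rule inj_on_subset) (auto simp: W_def)
    have "(\<lambda>u. u mod n) ` W n = (\<lambda>u. u mod n) ` {w..<w + n} - {j}" by (auto simp: W_def)
    then show "(\<lambda>u. u mod n) ` W n = {..<n} - {j}"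
      using bij_betw_imp_surj_on[OF bij_betw_mod_window[of w]] by simp
  qed
  then have "(\<Prod>u\<in>W n. m (u mod n)) = (\<Prod>k\<in>{..<n} - {j}. m k)"
    by (rule prod.reindex_bij_betw)
  moreover have "{b \<in> responses. fresh b a t \<and> agree_off j (state b a t) (state b a s)} \<subseteq> X n"
  proof clarify
    fix b assume b: "b \<in> responses" "fresh b a t" and ag: "agree_off j (state b a t) (state b a s)"
    have "state b a (Suc u) (u mod n) = state b a s (u mod n)" if "u \<in> {w..<w + n}" "u mod n \<noteq> j" for u
    proof -
      \<comment> \<open>The player moving at \<open>u\<close> moves again at \<open>u + n\<close> at
        the earliest, hence not before \<open>t\<close>.\<close>
      have "state b a t (u mod n) = state b a (Suc u) (u mod n)"
      proof (rule state_coord_stable)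
        show "Suc u \<le> t" using that w by simp
        fix u' assume "Suc u \<le> u'" "u' < t"
        then show "u' mod n \<noteq> u mod n" using mod_eq_imp_add_le[of u u'] that w by auto
      qed
      then show ?thesis using ag that n_pos by simp
    qed
    then show "b \<in> X n" using b w unfolding X_def by simp
  qed
  then have "card {b \<in> responses. fresh b a t \<and> agree_off j (state b a t) (state b a s)} \<le> card (X n)"
    using finX by (intro card_mono)
  ultimately show ?thesis
    using order_trans[OF mult_le_mono1 main[of n]] by simp
qed

text \<open>Each product times its missing factor is the full product. For maximal
  \<open>m i\<close> the left side is the \<open>q\<close> of the theorem, so bounds obtained for
  any mover can be weakened to \<open>q\<close>.\<close>

lemma prod_off_mono:
  assumes "i < n" "j < n" "m j \<le> m i"
  shows "(\<Prod>k\<in>{..<n} - {i}. m k) \<le> (\<Prod>k\<in>{..<n} - {j}. m k)"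
proof (rule ccontr)
  assume "\<not> ?thesis"
  then have "m j * (\<Prod>k\<in>{..<n} - {j}. m k) < m i * (\<Prod>k\<in>{..<n} - {i}. m k)"
    using assms m_pos[of i] m_pos[of j] by (intro mult_le_less_imp_less) auto
  then show False
    using assms prod.remove[of "{..<n}" i m] prod.remove[of "{..<n}" j m] by simp
qed

section \<open>Lower bound\<close>

text \<open>Queries at times \<open>s \<ge> t - n\<close> are deliberately allowed to match: player \<open>s mod n\<close> has not moved
  again before time \<open>t\<close>, so such a match already certifies its best-response condition at time \<open>t\<close>.\<close>

definition clear :: "(nat \<times> (nat \<Rightarrow> nat) \<Rightarrow> nat) \<Rightarrow> (nat \<Rightarrow> nat) \<Rightarrow> nat \<Rightarrow> bool" where
  "clear b a t \<longleftrightarrow> fresh b a t \<and> (\<forall>s. s + n < t \<longrightarrow> \<not> agree_off (s mod n) (state b a t) (state b a s))"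

text \<open>An entry relevant for the profile at \<open>Suc t\<close> either was read within the
  last round, and then already agrees, or is unread and can be deferred. The number of deferred
  entries varies with \<open>b\<close>, so the product over \<open>Q b\<close> is only bounded by
  the product over all players but the mover.\<close>

lemma card_clear_le:
  assumes a: "a \<in> profiles n m"
  shows "card {b \<in> responses. clear b a (Suc t)}
    \<le> card {b \<in> responses. clear b a (Suc t) \<and> nash b (state b a (Suc t))} * (\<Prod>k\<in>{..<n} - {t mod n}. m k)"
proof -
  let ?J = "{..<n} - {t mod n}"
  define Q where "Q b = (\<lambda>j. ctx j (state b a (Suc t))) ` ?J - query b a ` {..t}" for b
  define v where "v b c = state b a (Suc t) (fst c)" for b and c :: "nat \<times> (nat \<Rightarrow> nat)"
  define E where "E = {b \<in> responses. clear b a (Suc t)}"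
  let ?G = "{b. b \<in> E \<and> (\<forall>c\<in>Q b. b c = v b c)}"
  have E: "card E = (\<Sum>b\<in>?G. \<Prod>c\<in>Q b. card {..<m (fst c)})"
  proof (rule card_deferred_decisions[OF finite_contexts])
    show "E \<subseteq> PiE contexts (\<lambda>c. {..<m (fst c)})" by (auto simp: E_def responses_def)
    show "Q b \<subseteq> contexts" if "b \<in> E" for b
      using that a by (auto simp: E_def Q_def ctx_in_contexts state_in_profiles simp del: state.simps)
    show "v b c \<in> {..<m (fst c)}" if "b \<in> E" "c \<in> Q b" for b c
      using that a by (auto simp: E_def Q_def v_def state_less simp del: state.simps)
  next
    fix b b' assume b: "b \<in> E" and b': "b' \<in> PiE contexts (\<lambda>c. {..<m (fst c)})"
      and eq: "\<And>c. c \<in> contexts \<Longrightarrow> c \<notin> Q b \<Longrightarrow> b' c = b c"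
    have *: "b' (query b a u) = b (query b a u)" if "u < Suc t" for u
      using b that a by (intro eq) (auto simp: E_def Q_def query_in_contexts)
    have st: "state b' a u = state b a u" if "u \<le> Suc t" for u
      by (rule state_cong[OF _ that]) (rule *)
    have qu: "query b' a u = query b a u" if "u \<le> Suc t" for u
      by (rule query_cong[OF _ that]) (rule *)
    have "query b' a ` {..t} = query b a ` {..t}" using qu by (intro image_cong) auto
    then have "Q b' = Q b" "v b' = v b"
      unfolding Q_def v_def st[OF order_refl] by simp_all
    moreover have "fresh b' a (Suc t)" using b qu by (auto simp: E_def clear_def fresh_def inj_on_def)
    moreover have "\<not> agree_off (s mod n) (state b' a (Suc t)) (state b' a s)" if "s + n < Suc t" for s
      using b that st[of s] st[OF order_refl] by (simp add: E_def clear_def del: state.simps)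
    ultimately show "b' \<in> E \<and> Q b' = Q b \<and> v b' = v b"
      using b' by (simp add: E_def clear_def responses_def del: state.simps)
  qed auto
  have prod: "(\<Prod>c\<in>Q b. card {..<m (fst c)}) \<le> (\<Prod>k\<in>?J. m k)" for b
  proof -
    have "(\<Prod>c\<in>Q b. card {..<m (fst c)}) \<le> (\<Prod>c\<in>(\<lambda>j. ctx j (state b a (Suc t))) ` ?J. card {..<m (fst c)})"
      unfolding Q_def
      by (intro dvd_imp_le prod_dvd_prod_subset prod_pos) (auto dest: m_pos simp del: state.simps)
    also have "\<dots> = (\<Prod>k\<in>?J. m k)"
      by (subst prod.reindex) (auto simp: inj_on_def ctx_eq_iff)
    finally show ?thesis .
  qed
  have sub: "?G \<subseteq> {b \<in> E. nash b (state b a (Suc t))}"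
  proof
    fix b assume "b \<in> ?G"
    then have b: "b \<in> E" and agree: "\<forall>c\<in>Q b. b c = v b c" by auto
    have "b (ctx j (state b a (Suc t))) = state b a (Suc t) j" if j: "j < n" for j
    proof (cases "ctx j (state b a (Suc t)) \<in> query b a ` {..t}")
      case True
      then obtain u where u: "u \<le> t" "query b a u = ctx j (state b a (Suc t))" by auto
      then have uj: "u mod n = j" and off: "\<And>k. k \<noteq> j \<Longrightarrow> state b a u k = state b a (Suc t) k"
        by (auto simp: query_def ctx_eq_iff simp del: state.simps)
      have "agree_off (u mod n) (state b a (Suc t)) (state b a u)"
        using off uj by (simp del: state.simps)
      then have "\<not> u + n < Suc t"
        using b unfolding E_def clear_def by blast
      \<comment> \<open>\<open>clear\<close> excludes matches with \<open>u + n < Suc t\<close>, so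
        the next move of \<open>j\<close> after \<open>u\<close> does not come before
        \<open>Suc t\<close>.\<close>
      then have "u' mod n \<noteq> j" if "Suc u \<le> u'" "u' < Suc t" for u'
        using that uj mod_eq_imp_add_le[of u u'] by auto
      then have "state b a (Suc t) j = state b a (Suc u) j"
        using u(1) by (intro state_coord_stable) auto
      also have "\<dots> = b (query b a u)" using uj by (simp add: query_def)
      finally show ?thesis using u by simp
    next
      case False
      \<comment> \<open>The entry of the mover is exactly the query at time \<open>t\<close>, hence
        was read.\<close>
      have "j \<noteq> t mod n"
      proof
        assume "j = t mod n"
        then have "ctx j (state b a (Suc t)) = query b a t" by (simp add: query_def ctx_eq_iff)
        then show False using False by auto
      qed
      then have "ctx j (state b a (Suc t)) \<in> Q b" using False j unfolding Q_def by blast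
      then show ?thesis using agree by (simp add: v_def del: state.simps)
    qed
    then show "b \<in> {b \<in> E. nash b (state b a (Suc t))}" using b by (simp add: nash_def del: state.simps)
  qed
  have "card E \<le> card ?G * (\<Prod>k\<in>?J. m k)"
    unfolding E using sum_bounded_above[of ?G, OF prod] by simp
  also have "\<dots> \<le> card {b \<in> E. nash b (state b a (Suc t))} * (\<Prod>k\<in>?J. m k)"
    using finite_responses by (intro mult_le_mono1 card_mono sub) (auto simp: E_def)
  finally show ?thesis by (simp add: E_def conj_assoc del: state.simps)
qed

section \<open>Union bound over collisions\<close>

text \<open>The dynamic stays at the equilibrium, so the same player later reads the same entry
  again. This makes the events of different rounds disjoint in the lower bound.\<close>

lemma nash_imp_not_fresh:
  assumes "nash b (state b a (Suc t))" "t < t'" "t mod n = t' mod n"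
  shows "\<not> fresh b a (Suc t')"
proof -
  have "state b a t' = state b a (Suc t)"
    using assms by (intro nash_persists) auto
  then have "query b a t' = query b a t"
    using assms(3) by (simp add: query_def ctx_eq_iff)
  then show ?thesis
    using assms(2) inj_onD[of "query b a" "{..<Suc t'}" t' t] by (auto simp: fresh_def)
qed

text \<open>Taking the earliest repeated query makes the run fresh up to \<open>u\<close>, as
  \<open>card_collision\<close> requires.\<close>

lemma not_fresh_first_collision:
  assumes "\<not> fresh b a t"
  obtains s u where "s < u" "u < t" "s mod n = u mod n" "fresh b a u"
    "agree_off (u mod n) (state b a u) (state b a s)"
proof -
  from assms have "\<exists>s u. s < u \<and> u < t \<and> fresh b a u \<and> query b a u = query b a s"
  proof (induction t)
    case (Suc t)
    show ?case
    proof (cases "fresh b a t")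
      case True
      with Suc.prems obtain s where "s < t" "query b a t = query b a s"
        by (auto simp: fresh_def lessThan_Suc)
      then show ?thesis using True by blast
    next
      case False
      then show ?thesis using Suc.IH less_Suc_eq by metis
    qed
  qed (simp add: fresh_def)
  then show ?thesis
    using that by (auto simp: query_def ctx_eq_iff)
qed

lemma sum_div_blocks: "2 * (\<Sum>u<(r + 1) * n. u div n) = n * r * (r + 1)"
proof -
  have "(\<Sum>u<(r + 1) * n. u div n) = (\<Sum>k<r + 1. \<Sum>u\<in>{k * n..<k * n + n}. u div n)"
    by (simp add: sum.nat_group)
  also have "\<dots> = (\<Sum>k<r + 1. n * k)"
  proof (rule sum.cong[OF refl])
    fix k
    have "u div n = k" if "u \<in> {k * n..<k * n + n}" for u
      using that by (intro div_nat_eqI) (auto simp: mult.commute)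
    then show "(\<Sum>u\<in>{k * n..<k * n + n}. u div n) = n * k" by simp
  qed
  also have "2 * \<dots> = n * r * (r + 1)"
    by (induction r) (auto simp: algebra_simps)
  finally show ?thesis .
qed

text \<open>Bounds the number of earlier queries that the query at \<open>u\<close> can repeat,
  since only moves of the same player count.\<close>

lemma card_congruent_below: "card {s. s < u \<and> s mod n = u mod n} \<le> u div n"
proof -
  have "s \<in> (\<lambda>x. x * n + u mod n) ` {..<u div n}" if "s < u" "s mod n = u mod n" for s
  proof (rule image_eqI)
    show "s = s div n * n + u mod n" using that by (metis div_mult_mod_eq)
    have "s div n * n < u div n * n" using that by (metis add_less_cancel_right div_mult_mod_eq)
    then show "s div n \<in> {..<u div n}" by simp
  qed
  then have "{s. s < u \<and> s mod n = u mod n} \<subseteq> (\<lambda>x. x * n + u mod n) ` {..<u div n}" by blast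
  then have "card {s. s < u \<and> s mod n = u mod n} \<le> card ((\<lambda>x. x * n + u mod n) ` {..<u div n})"
    by (intro card_mono) auto
  also have "\<dots> \<le> u div n" using card_image_le[of "{..<u div n}"] by simp
  finally show ?thesis .
qed

text \<open>Repeated queries contribute at most \<open>n * r * (r + 1) / 2\<close> pairs of times,
  matches of the final profile at most \<open>n * r\<close> times, and each collision has
  probability at most \<open>1 / q\<close>.\<close>

lemma card_not_clear_le:
  assumes a: "a \<in> profiles n m" and i: "i < n" and max: "\<And>k. k < n \<Longrightarrow> m k \<le> m i"
  defines "q \<equiv> \<Prod>k\<in>{..<n} - {i}. m k"
  shows "2 * card {b \<in> responses. \<not> clear b a (Suc (r * n + i))} * q \<le> n * r * (r + 3) * card responses"
proof -
  let ?t = "Suc (r * n + i)"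
  define K where "K s t = {b \<in> responses. fresh b a t \<and> agree_off (s mod n) (state b a t) (state b a s)}" for s t
  have K: "card (K s t) * q \<le> card responses" if "s + n \<le> t" for s t
  proof -
    have "card (K s t) * q \<le> card (K s t) * (\<Prod>k\<in>{..<n} - {s mod n}. m k)"
      unfolding q_def using i max n_pos by (intro mult_le_mono2 prod_off_mono) auto
    also have "\<dots> \<le> card responses"
      unfolding K_def by (rule card_collision[OF a that])
    finally show ?thesis .
  qed
  have sumK: "(\<Sum>s\<in>S. card (K s u)) * q \<le> card S * card responses" if "\<And>s. s \<in> S \<Longrightarrow> s + n \<le> u" for S u
    using sum_bounded_above[of S "\<lambda>s. card (K s u) * q" "card responses"] K that
    by (simp add: sum_distrib_right)
  define S where "S u = {s. s < u \<and> s mod n = u mod n}" for u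
  have finS: "finite (S u)" for u by (simp add: S_def)
  define T where "T = {s. s + n < ?t}"
  have T: "finite T" "card T \<le> r * n"
  proof -
    have "T = {..<?t - n}" by (auto simp: T_def)
    \<comment> \<open>\<open>i < n\<close> gives \<open>?t - n \<le> r * n\<close>.\<close>
    then show "finite T" "card T \<le> r * n" using i by auto
  qed
  have finK: "finite (K s u)" for s u using finite_responses by (simp add: K_def)
  have "{b \<in> responses. \<not> clear b a ?t} \<subseteq> (\<Union>u<?t. \<Union>s\<in>S u. K s u) \<union> (\<Union>s\<in>T. K s ?t)"
  proof clarify
    fix b assume b: "b \<in> responses" "\<not> clear b a ?t" and no: "b \<notin> (\<Union>s\<in>T. K s ?t)"
    have "\<not> fresh b a ?t"
    proof
      assume "fresh b a ?t"
      then obtain s where "s + n < ?t" "agree_off (s mod n) (state b a ?t) (state b a s)"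
        using b unfolding clear_def by blast
      then have "b \<in> (\<Union>s\<in>T. K s ?t)"
        using b \<open>fresh b a ?t\<close> unfolding K_def T_def by blast
      then show False using no by blast
    qed
    then obtain s u where "s < u" "u < ?t" "s mod n = u mod n" "fresh b a u"
      "agree_off (u mod n) (state b a u) (state b a s)" by (rule not_fresh_first_collision)
    then have "u \<in> {..<?t}" "s \<in> S u" "b \<in> K s u" using b unfolding S_def K_def by simp_all
    then show "b \<in> (\<Union>u<?t. \<Union>s\<in>S u. K s u)" by blast
  qed
  then have "card {b \<in> responses. \<not> clear b a ?t} \<le> card ((\<Union>u<?t. \<Union>s\<in>S u. K s u) \<union> (\<Union>s\<in>T. K s ?t))"
    using finK finS T by (intro card_mono) auto
  also have "\<dots> \<le> card (\<Union>u<?t. \<Union>s\<in>S u. K s u) + card (\<Union>s\<in>T. K s ?t)"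
    by (rule card_Un_le)
  also have "\<dots> \<le> (\<Sum>u<?t. \<Sum>s\<in>S u. card (K s u)) + (\<Sum>s\<in>T. card (K s ?t))"
    using finS T by (intro add_mono card_UN_le order_trans[OF card_UN_le sum_mono]) auto
  finally have "card {b \<in> responses. \<not> clear b a ?t} * q
      \<le> ((\<Sum>u<?t. \<Sum>s\<in>S u. card (K s u)) + (\<Sum>s\<in>T. card (K s ?t))) * q"
    by (rule mult_le_mono1)
  also have "\<dots> = (\<Sum>u<?t. (\<Sum>s\<in>S u. card (K s u)) * q) + (\<Sum>s\<in>T. card (K s ?t)) * q"
    by (simp only: add_mult_distrib sum_distrib_right)
  also have "\<dots> \<le> (\<Sum>u<?t. u div n * card responses) + r * n * card responses"
  proof (intro add_mono sum_mono)
    fix u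
    have "(\<Sum>s\<in>S u. card (K s u)) * q \<le> card (S u) * card responses"
      by (rule sumK) (auto simp: S_def mod_eq_imp_add_le)
    also have "\<dots> \<le> u div n * card responses"
      unfolding S_def by (intro mult_le_mono1 card_congruent_below)
    finally show "(\<Sum>s\<in>S u. card (K s u)) * q \<le> u div n * card responses" .
  next
    have "(\<Sum>s\<in>T. card (K s ?t)) * q \<le> card T * card responses"
      by (rule sumK) (auto simp: T_def)
    also have "\<dots> \<le> r * n * card responses" using T by (intro mult_le_mono1)
    finally show "(\<Sum>s\<in>T. card (K s ?t)) * q \<le> r * n * card responses" .
  qed
  also have "\<dots> = ((\<Sum>u<?t. u div n) + r * n) * card responses"
    by (simp add: sum_distrib_right add_mult_distrib)
  \<comment> \<open>The range is enlarged to \<open>r + 1\<close> full rounds, where the sum has a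
    closed form.\<close>
  also have "\<dots> \<le> ((\<Sum>u<(r + 1) * n. u div n) + r * n) * card responses"
    using i by (intro mult_le_mono1 add_mono sum_mono2) auto
  finally have "2 * card {b \<in> responses. \<not> clear b a ?t} * q
     \<le> (2 * (\<Sum>u<(r + 1) * n. u div n) + 2 * r * n) * card responses"
    by (simp add: algebra_simps)
  also have "\<dots> = n * r * (r + 3) * card responses"
    unfolding sum_div_blocks by (simp add: algebra_simps)
  finally show ?thesis .
qed

section \<open>Numbers of tables for which an equilibrium is hit\<close>

lemma card_responses_pos: "0 < card responses"
  unfolding responses_def card_PiE[OF finite_contexts]
  using m_pos by (intro prod_pos) (auto simp: contexts_def)

text \<open>Splitting by the first hitting time, every step adds at most a fraction
  \<open>1 / q\<close> of the tables.\<close>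

lemma card_hits_le:
  assumes a: "a \<in> profiles n m" and i: "i < n" and max: "\<And>k. k < n \<Longrightarrow> m k \<le> m i"
  shows "card {b \<in> responses. \<exists>s\<in>{1..t}. nash b (state b a s)} * (\<Prod>k\<in>{..<n} - {i}. m k)
    \<le> t * card responses"
proof (induction t)
  case (Suc t)
  let ?A = "{b \<in> responses. \<exists>s\<in>{1..t}. nash b (state b a s)}"
  let ?N = "{b \<in> responses. nash b (state b a (Suc t)) \<and> (\<forall>s\<in>{1..t}. \<not> nash b (state b a s))}"
  let ?q = "\<Prod>k\<in>{..<n} - {i}. m k"
  have "{b \<in> responses. \<exists>s\<in>{1..Suc t}. nash b (state b a s)} \<subseteq> ?A \<union> ?N"
    by (auto simp: le_Suc_eq simp del: state.simps)
  then have "card {b \<in> responses. \<exists>s\<in>{1..Suc t}. nash b (state b a s)} \<le> card (?A \<union> ?N)"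
    using finite_responses by (intro card_mono) auto
  also have "\<dots> \<le> card ?A + card ?N" by (rule card_Un_le)
  finally have "card {b \<in> responses. \<exists>s\<in>{1..Suc t}. nash b (state b a s)} * ?q \<le> card ?A * ?q + card ?N * ?q"
    unfolding add_mult_distrib[symmetric] by (rule mult_le_mono1)
  moreover have "card ?N * ?q \<le> card ?N * (\<Prod>k\<in>{..<n} - {t mod n}. m k)"
    using i max n_pos by (intro mult_le_mono2 prod_off_mono) auto
  ultimately show ?case
    using Suc card_first_nash[OF a, of t] unfolding mult_Suc by linarith
qed simp

lemma card_hits_ge:
  assumes a: "a \<in> profiles n m" and i: "i < n" and max: "\<And>k. k < n \<Longrightarrow> m k \<le> m i"
  defines "q \<equiv> real (\<Prod>k\<in>{..<n} - {i}. m k)"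
  shows "real k * (1 / q) * (1 - (real k)\<^sup>2 / 2 * (real n / q)) * card responses
    \<le> card {b \<in> responses. \<exists>s\<in>{1..k * n}. nash b (state b a s)}"
proof -
  let ?N = "real (card responses)"
  \<comment> \<open>The player moving at time \<open>r * n + i\<close> is \<open>i\<close>, so the
    product over the other players is exactly \<open>q\<close>.\<close>
  define F where "F r = {b \<in> responses. clear b a (Suc (r * n + i)) \<and> nash b (state b a (Suc (r * n + i)))}" for r
  have q: "q > 0" unfolding q_def of_nat_0_less_iff using m_pos by (intro prod_pos) auto
  have finF: "finite (F r)" for r using finite_responses by (simp add: F_def)
  have F: "?N / q * (1 - n / (2 * q) * (r * (r + 3))) \<le> card (F r)" for r :: nat
  proof -
    let ?C = "{b \<in> responses. clear b a (Suc (r * n + i))}"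
    let ?B = "{b \<in> responses. \<not> clear b a (Suc (r * n + i))}"
    have "card responses = card (?C \<union> ?B)" by (rule arg_cong[of _ _ card]) auto
    also have "\<dots> = card ?C + card ?B"
      using finite_responses by (intro card_Un_disjoint) auto
    finally have "?N = real (card ?C) + real (card ?B)" by simp
    moreover have "real (card ?C) \<le> real (card (F r)) * q"
      using card_clear_le[OF a, of "r * n + i"] i unfolding F_def q_def
      by (simp only: of_nat_mult[symmetric] of_nat_le_iff) simp
    moreover have "real (2 * card ?B * (\<Prod>k\<in>{..<n} - {i}. m k)) \<le> real (n * r * (r + 3) * card responses)"
      using card_not_clear_le[OF a i max, of r] of_nat_le_iff by blast
    then have "2 * real (card ?B) * q \<le> n * r * (r + 3) * ?N"
      unfolding q_def by simp
    then have "real (card ?B) \<le> n * r * (r + 3) * ?N / (2 * q)"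
      using q by (simp add: field_simps)
    ultimately have "?N - n * r * (r + 3) * ?N / (2 * q) \<le> card (F r) * q" by linarith
    then have "(?N - n * r * (r + 3) * ?N / (2 * q)) / q \<le> card (F r)"
      using q by (simp add: pos_divide_le_eq)
    then show ?thesis by (simp add: algebra_simps diff_divide_distrib add_divide_distrib)
  qed
  have sum: "(\<Sum>r<k. real r * (real r + 3)) \<le> real k ^ 3"
  proof -
    have "3 * (\<Sum>r<k. real r * (real r + 3)) = real k * ((real k)\<^sup>2 + 3 * real k - 4)"
      by (induction k) (auto simp: algebra_simps power2_eq_square)
    also have "\<dots> \<le> real k * (3 * (real k)\<^sup>2)"
    proof (rule mult_left_mono)
      \<comment> \<open>The difference of the two sides below is
        \<open>2 * (k - 3/4)^2 + 23/8\<close>.\<close>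
      have "0 \<le> (real k - 3/4)\<^sup>2" by simp
      then show "(real k)\<^sup>2 + 3 * real k - 4 \<le> 3 * (real k)\<^sup>2"
        by (simp add: power2_eq_square algebra_simps)
    qed simp
    finally show ?thesis by (simp add: power2_eq_square power3_eq_cube)
  qed
  have "real k * (1 / q) * (1 - (real k)\<^sup>2 / 2 * (real n / q)) * ?N = ?N / q * (k - n / (2 * q) * real k ^ 3)"
    by (simp add: field_simps power2_eq_square power3_eq_cube)
  also have "\<dots> \<le> ?N / q * (k - n / (2 * q) * (\<Sum>r<k. real r * (real r + 3)))"
    using sum q by (intro mult_left_mono diff_left_mono) auto
  also have "\<dots> = (\<Sum>r<k. ?N / q * (1 - n / (2 * q) * (r * (r + 3))))"
    by (simp only: sum_distrib_left[symmetric] sum_subtractf) simp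
  also have "\<dots> \<le> (\<Sum>r<k. real (card (F r)))"
    by (intro sum_mono F)
  also have "\<dots> = card (\<Union>r<k. F r)"
  proof -
    have "F r \<inter> F r' = {}" if "r < r'" for r r'
    proof -
      have "r * n + i < r' * n + i" using that n_pos by simp
      then show ?thesis
        using nash_imp_not_fresh[of _ a "r * n + i" "r' * n + i"] by (auto simp: F_def clear_def simp del: state.simps)
    qed
    then have "F r \<inter> F r' = {}" if "r \<noteq> r'" for r r'
      using that by (metis inf_commute nat_neq_iff)
    then show ?thesis using finF by (subst card_UN_disjoint) auto
  qed
  also have "\<dots> \<le> card {b \<in> responses. \<exists>s\<in>{1..k * n}. nash b (state b a s)}"
  proof (intro of_nat_mono card_mono)
    show "(\<Union>r<k. F r) \<subseteq> {b \<in> responses. \<exists>s\<in>{1..k * n}. nash b (state b a s)}"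
    proof
      fix b assume "b \<in> (\<Union>r<k. F r)"
      then obtain r where r: "r < k" "b \<in> responses" "nash b (state b a (Suc (r * n + i)))"
        unfolding F_def by blast
      have "Suc (r * n + i) \<le> (r + 1) * n" using i by simp
      also have "\<dots> \<le> k * n" using r by (intro mult_le_mono1) auto
      finally show "b \<in> {b \<in> responses. \<exists>s\<in>{1..k * n}. nash b (state b a s)}" using r by force
    qed
  qed (use finite_responses in auto)
  finally show ?thesis .
qed

section \<open>Random payoffs induce a uniform best-response table\<close>

lemma best_response_upd [simp]: "best_response m U i (a(i := x)) = best_response m U i a"
  by (simp add: best_response_def)

text \<open>A maximum over the finite nonempty action set is attained, so the \<open>LEAST\<close>
  ranges over a satisfiable condition.\<close>

lemma best_response_maximal:
  assumes "i < n"
  shows "best_response m U i a < m i"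
    and "y < m i \<Longrightarrow> U (i, a(i := y)) \<le> U (i, a(i := best_response m U i a))"
proof -
  let ?u = "\<lambda>y. U (i, a(i := y))"
  have "Max (?u ` {..<m i}) \<in> ?u ` {..<m i}"
    using m_pos[OF assms] by (intro Max_in) auto
  then obtain x where "x < m i" "?u x = Max (?u ` {..<m i})" by auto
  then have "x < m i \<and> (\<forall>y<m i. ?u y \<le> ?u x)" by simp
  from LeastI[of "\<lambda>x. x < m i \<and> (\<forall>y<m i. ?u y \<le> ?u x)", OF this]
  show "best_response m U i a < m i"
    and "y < m i \<Longrightarrow> U (i, a(i := y)) \<le> U (i, a(i := best_response m U i a))"
    unfolding best_response_def by auto
qed

text \<open>Restricted to \<open>contexts\<close> so that the table is extensional and belongs to
  \<open>responses\<close>.\<close>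

definition response_fun :: "(nat \<times> (nat \<Rightarrow> nat) \<Rightarrow> real) \<Rightarrow> nat \<times> (nat \<Rightarrow> nat) \<Rightarrow> nat" where
  "response_fun U = (\<lambda>c\<in>contexts. best_response m U (fst c) (snd c))"

lemma response_fun_ctx:
  "a \<in> profiles n m \<Longrightarrow> i < n \<Longrightarrow> response_fun U (ctx i a) = best_response m U i a"
  using ctx_in_contexts[of a i] by (simp add: response_fun_def) (simp add: ctx_def)

lemma response_fun_in_responses: "response_fun U \<in> responses"
  by (auto simp: response_fun_def responses_def contexts_def best_response_maximal)

lemma clockwork_eq_state:
  "a \<in> profiles n m \<Longrightarrow> clockwork n m U a t = state (response_fun U) a t"
  by (induction t)
    (simp_all add: Let_def response_fun_ctx state_in_profiles response_fun_in_responses n_pos)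

lemma is_PNE_iff_nash:
  "a \<in> profiles n m \<Longrightarrow> is_PNE n m U a \<longleftrightarrow> nash (response_fun U) a"
  by (auto simp: is_PNE_def nash_def response_fun_ctx)

lemma hitting_time_le_iff:
  "hitting_time n m U a \<le> enat t \<longleftrightarrow> (\<exists>s\<in>{1..t}. is_PNE n m U (clockwork n m U a s))"
proof
  let ?S = "{enat s | s. s \<ge> 1 \<and> is_PNE n m U (clockwork n m U a s)}"
  assume le: "hitting_time n m U a \<le> enat t"
  \<comment> \<open>The infimum of the empty set is infinite; that of a nonempty set of extended
    naturals is attained.\<close>
  have "?S \<noteq> {}"
  proof
    assume "?S = {}"
    then have "hitting_time n m U a = \<infinity>"
      unfolding hitting_time_def by (simp only: Inf_enat_def) simp
    then show False using le by simp
  qed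
  then have "Inf ?S \<in> ?S" unfolding Inf_enat_def by (auto intro: LeastI)
  then show "\<exists>s\<in>{1..t}. is_PNE n m U (clockwork n m U a s)"
    using le by (auto simp: hitting_time_def)
next
  assume "\<exists>s\<in>{1..t}. is_PNE n m U (clockwork n m U a s)"
  then obtain s where "s \<in> {1..t}" "is_PNE n m U (clockwork n m U a s)" by blast
  then have "hitting_time n m U a \<le> enat s"
    unfolding hitting_time_def by (intro Inf_lower) auto
  also have "\<dots> \<le> enat t" using \<open>s \<in> {1..t}\<close> by simp
  finally show "hitting_time n m U a \<le> enat t" .
qed

lemma hitting_time_le_iff_nash:
  assumes "a \<in> profiles n m"
  shows "hitting_time n m U a \<le> enat t
    \<longleftrightarrow> (\<exists>s\<in>{1..t}. nash (response_fun U) (state (response_fun U) a s))"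
  using assms by (simp add: hitting_time_le_iff clockwork_eq_state is_PNE_iff_nash
      state_in_profiles response_fun_in_responses)

end

section \<open>Measurability, absence of ties and symmetry of the payoffs\<close>

locale random_clockwork_game = clockwork_game +
  fixes D :: "real measure"
  assumes prob_D: "prob_space D" and sets_D: "sets D = sets borel"
    and atomless_D: "\<And>x. measure D {x} = 0"
begin

abbreviation M :: "(nat \<times> (nat \<Rightarrow> nat) \<Rightarrow> real) measure" where
  "M \<equiv> PiM (payoff_index n m) (\<lambda>_. D)"

lemma prob_space_M: "prob_space M"
  by (intro prob_space_PiM prob_D)

lemma finite_payoff_index: "finite (payoff_index n m)"
  by (simp add: payoff_index_def finite_profiles)

lemma measurable_payoff: "(\<lambda>U. U p) \<in> borel_measurable M"
proof (cases "p \<in> payoff_index n m")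
  case True
  then have "(\<lambda>U. U p) \<in> measurable M D" by (rule measurable_component_singleton)
  then show ?thesis using measurable_cong_sets[OF refl sets_D] by blast
next
  case False
  \<comment> \<open>Off the index set every point of the product space takes the constant value
    \<open>undefined\<close>, so measurability extends to all \<open>p\<close>.\<close>
  have "U p = undefined" if "U \<in> space M" for U
    using that False unfolding space_PiM by (intro PiE_arb)
  then show ?thesis by (subst measurable_cong[where g = "\<lambda>_. undefined"]) auto
qed

lemma measurable_best_response [measurable]:
  "(\<lambda>U. best_response m U i a) \<in> measurable M (count_space UNIV)"
proof -
  have "Measurable.pred M (\<lambda>U. U p \<le> U p')" for p p'
    unfolding pred_def using measurable_payoff by (intro borel_measurable_le)
  then show ?thesis
    unfolding best_response_def
    by (intro measurable_Least pred_intros_logic pred_intros_countable) auto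
qed

text \<open>The profile before a move differs from the one after it at most in the mover's
  coordinate, whose old value \<open>x\<close> ranges over a countable type. The best response can
  thus be evaluated at the fixed profile \<open>a'\<close>.\<close>

lemma pred_clockwork: "Measurable.pred M (\<lambda>U. clockwork n m U a t = a')"
proof (induction t arbitrary: a')
  case (Suc t)
  note Suc.IH [measurable]
  let ?i = "t mod n"
  have "clockwork n m U a (Suc t) = a'
    \<longleftrightarrow> (\<exists>x. clockwork n m U a t = a'(?i := x) \<and> best_response m U ?i a' = a' ?i)" for U
  proof
    assume L: "clockwork n m U a (Suc t) = a'"
    let ?a = "clockwork n m U a t"
    have a': "a' = ?a(?i := best_response m U ?i ?a)" using L by (simp add: Let_def)
    have "?a = a'(?i := ?a ?i)" by (subst a') simp
    moreover have "best_response m U ?i a' = a' ?i" by (subst (1 2) a') simp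
    ultimately show "\<exists>x. ?a = a'(?i := x) \<and> best_response m U ?i a' = a' ?i" by blast
  next
    assume "\<exists>x. clockwork n m U a t = a'(?i := x) \<and> best_response m U ?i a' = a' ?i"
    then show "clockwork n m U a (Suc t) = a'" by (auto simp: Let_def)
  qed
  then show ?case by simp
qed simp

lemma pred_hitting_time: "Measurable.pred M (\<lambda>U. hitting_time n m U a \<le> enat t)"
proof -
  note pred_clockwork [measurable]
  have [measurable]: "Measurable.pred M (\<lambda>U. is_PNE n m U (clockwork n m U a s))" for s
  proof -
    \<comment> \<open>Splitting over the finitely many profiles replaces the random profile by fixed
      ones.\<close>
    have eq: "is_PNE n m U (clockwork n m U a s) \<longleftrightarrow>
      (\<exists>a'\<in>profiles n m. clockwork n m U a s = a' \<and> (\<forall>i\<in>{..<n}. a' i = best_response m U i a'))" for U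
      by (auto simp: is_PNE_def)
    show ?thesis unfolding eq
      by (intro pred_intros_finite pred_intros_logic finite_profiles finite_lessThan) measurable
  qed
  show ?thesis unfolding hitting_time_le_iff by measurable
qed

lemma pred_response_fun:
  assumes "b \<in> responses"
  shows "Measurable.pred M (\<lambda>U. response_fun U = b)"
proof -
  have eq: "response_fun U = b \<longleftrightarrow> (\<forall>c\<in>contexts. best_response m U (fst c) (snd c) = b c)" for U
    using assms by (auto simp: response_fun_def responses_def PiE_iff fun_eq_iff extensional_def)
  show ?thesis unfolding eq by (intro pred_intros_finite finite_contexts) measurable
qed

text \<open>By Fubini the coordinate \<open>p\<close> is integrated first: with the others fixed, a
  tie confines it to the single point \<open>x p'\<close>, which is null.\<close>

lemma AE_payoffs_distinct:
  assumes p: "p \<in> payoff_index n m" and p': "p' \<in> payoff_index n m" and neq: "p \<noteq> p'"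
  shows "AE U in M. U p \<noteq> U p'"
proof -
  interpret D: prob_space D by (rule prob_D)
  interpret P: product_sigma_finite "\<lambda>_. D" ..
  let ?J = "payoff_index n m - {p}"
  have ins: "insert p ?J = payoff_index n m" using p by auto
  have [measurable]: "{U \<in> space M. U p = U p'} \<in> sets M"
    using measurable_payoff by (intro borel_measurable_eq)
  have "emeasure M {U \<in> space M. U p = U p'} = (\<integral>\<^sup>+U. indicator {U \<in> space M. U p = U p'} U \<partial>M)"
    by simp
  also have "\<dots> = (\<integral>\<^sup>+x. \<integral>\<^sup>+y. indicator {U \<in> space M. U p = U p'} (x(p := y)) \<partial>D \<partial>PiM ?J (\<lambda>_. D))"
    using P.product_nn_integral_insert[of ?J p "indicator {U \<in> space M. U p = U p'}"] finite_payoff_index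
    unfolding ins by simp
  also have "\<dots> \<le> (\<integral>\<^sup>+x. \<integral>\<^sup>+y. indicator {x p'} y \<partial>D \<partial>PiM ?J (\<lambda>_. D))"
    using neq by (intro nn_integral_mono) (auto simp: indicator_def)
  also have "\<dots> = (\<integral>\<^sup>+x. 0 \<partial>PiM ?J (\<lambda>_. D))"
    using atomless_D by (intro nn_integral_cong) (simp add: sets_D D.emeasure_eq_measure)
  finally have "emeasure M {U \<in> space M. U p = U p'} = 0" by simp
  then show ?thesis
    by (intro AE_I[where N = "{U \<in> space M. U p = U p'}"]) auto
qed

text \<open>Swapping the actions \<open>b c\<close> and \<open>b' c\<close> at every context \<open>c\<close> preserves the payoff distribution and,
  in the absence of ties, turns the table \<open>b\<close> into \<open>b'\<close>.\<close>

lemma measure_response_fun_le: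
  assumes b: "b \<in> responses" and b': "b' \<in> responses"
  shows "measure M {U \<in> space M. response_fun U = b} \<le> measure M {U \<in> space M. response_fun U = b'}"
proof -
  interpret prob_space M by (rule prob_space_M)
  let ?I = "payoff_index n m"
  \<comment> \<open>The transposition depends on \<open>a\<close> only through the context of
    \<open>i\<close>, which it leaves unchanged; hence \<open>f\<close> is an involution.\<close>
  define \<tau> where "\<tau> i a = Transposition.transpose (b (ctx i a)) (b' (ctx i a))" for i a
  define f where "f = (\<lambda>(i, a). (i, a(i := \<tau> i a (a i))))"
  define T where "T U = (\<lambda>p\<in>?I. U (f p))" for U :: "nat \<times> (nat \<Rightarrow> nat) \<Rightarrow> real"
  have ctx_upd: "ctx i (a(i := x)) = ctx i a" for i x a by (simp add: ctx_def)
  have \<tau>_upd: "\<tau> i (a(i := x)) = \<tau> i a" for i x a by (simp add: \<tau>_def ctx_upd)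
  have \<tau>_less: "\<tau> i a x < m i" if "a \<in> profiles n m" "i < n" "x < m i" for i a x
    using that response_less[OF b] response_less[OF b'] by (auto simp: \<tau>_def Transposition.transpose_def)
  have ff: "f (f p) = p" for p
    by (cases p) (simp add: f_def \<tau>_upd, simp add: \<tau>_def)
  have f_in: "f p \<in> ?I" if "p \<in> ?I" for p
  proof -
    obtain i a where p: "p = (i, a)" "i < n" "a \<in> profiles n m"
      using \<open>p \<in> ?I\<close> by (auto simp: payoff_index_def)
    then have "a i < m i" by (auto simp: profiles_def PiE_iff)
    then show ?thesis using p by (simp add: f_def payoff_index_def upd_profile \<tau>_less)
  qed
  \<comment> \<open>Reindexing independent, identically distributed coordinates along an injection
    preserves their joint law.\<close>
  have distr: "distr M M T = M"
    unfolding T_def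
    using distr_PiM_reindex[of ?I "\<lambda>_. D" f ?I] inj_on_inverseI[of ?I f f, OF ff] f_in prob_D by simp
  have [measurable]: "T \<in> measurable M M"
    unfolding T_def using f_in by (intro measurable_restrict measurable_component_singleton) auto
  have "AE U in M. \<forall>p\<in>?I. \<forall>p'\<in>?I. p \<noteq> p' \<longrightarrow> U p \<noteq> U p'"
    using AE_payoffs_distinct by (intro AE_finite_allI finite_payoff_index AE_impI) auto
  then have imp: "AE U in M. response_fun U = b \<longrightarrow> response_fun (T U) = b'"
  proof (rule AE_mp, intro AE_I2 impI)
    fix U assume dist: "\<forall>p\<in>?I. \<forall>p'\<in>?I. p \<noteq> p' \<longrightarrow> U p \<noteq> U p'" and U: "response_fun U = b"
    have "best_response m (T U) i a = b' (i, a)" if c: "(i, a) \<in> contexts" for i a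
    proof -
      have i: "i < n" and a: "a \<in> profiles n m" and ctx: "ctx i a = (i, a)"
        using c by (auto simp: contexts_def ctx_def)
      let ?x = "b (i, a)" and ?x' = "b' (i, a)"
      have x: "?x < m i" "?x' < m i"
        using response_less[OF b a i] response_less[OF b' a i] by (simp_all add: ctx)
      have br: "best_response m U i a = ?x"
        using fun_cong[OF U, of "(i, a)"] c by (simp add: response_fun_def)
      have I: "(i, a(i := y)) \<in> ?I" if "y < m i" for y
        using that i a by (simp add: payoff_index_def upd_profile)
      have TU: "T U (i, a(i := y)) = U (i, a(i := \<tau> i a y))" if "y < m i" for y
        using I[OF that] by (simp add: T_def f_def \<tau>_upd)
      have \<tau>x': "\<tau> i a ?x' = ?x" by (simp add: \<tau>_def ctx)
      show ?thesis unfolding best_response_def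
      proof (rule Least_equality)
        show "?x' < m i \<and> (\<forall>y<m i. T U (i, a(i := y)) \<le> T U (i, a(i := ?x')))"
          using x best_response_maximal(2)[OF i, of _ U a] \<tau>_less[OF a i] by (simp add: TU \<tau>x' br)
      next
        fix z assume z: "z < m i \<and> (\<forall>y<m i. T U (i, a(i := y)) \<le> T U (i, a(i := z)))"
        then have "U (i, a(i := ?x)) \<le> U (i, a(i := \<tau> i a z))"
          using x TU \<tau>x' by metis
        moreover have "U (i, a(i := \<tau> i a z)) \<le> U (i, a(i := ?x))"
          using best_response_maximal(2)[OF i, of "\<tau> i a z" U a] \<tau>_less[OF a i] z by (simp add: br)
        ultimately have "U (i, a(i := \<tau> i a z)) = U (i, a(i := ?x))" by simp
        moreover have "(i, a(i := \<tau> i a z)) \<in> ?I" "(i, a(i := ?x)) \<in> ?I"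
          using I x(1) \<tau>_less[OF a i] z by simp_all
        \<comment> \<open>Without ties, equal payoffs force equal indices, so the maximizer is
          unique.\<close>
        ultimately have "a(i := \<tau> i a z) = a(i := ?x)"
          using dist by auto
        then have "\<tau> i a z = ?x" by (metis fun_upd_same)
        moreover have "\<tau> i a (\<tau> i a z) = z" by (simp add: \<tau>_def)
        ultimately have "z = \<tau> i a ?x" by simp
        then have "z = ?x'" by (simp add: \<tau>_def ctx)
        then show "?x' \<le> z" by simp
      qed
    qed
    then show "response_fun (T U) = b'"
      using b' by (auto simp: response_fun_def responses_def PiE_iff fun_eq_iff extensional_def)
  qed
  have S: "{U \<in> space M. response_fun U = b'} \<in> sets M"
    using pred_response_fun[OF b'] by (simp add: pred_def)
  have "measure M {U \<in> space M. response_fun U = b} \<le> measure M (T -` {U \<in> space M. response_fun U = b'} \<inter> space M)"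
    using imp measurable_sets[OF \<open>T \<in> measurable M M\<close> S] measurable_space[OF \<open>T \<in> measurable M M\<close>]
    by (intro finite_measure_mono_AE) auto
  also have "\<dots> = measure (distr M M T) {U \<in> space M. response_fun U = b'}"
    using S by (simp add: measure_distr)
  finally show ?thesis by (simp add: distr)
qed

text \<open>Exchanging \<open>b\<close> and \<open>b'\<close> in
  \<open>measure_response_fun_le\<close> shows that all tables are equally likely, and their
  probabilities sum to 1.\<close>

lemma measure_response_fun_in:
  assumes X: "X \<subseteq> responses"
  shows "measure M {U \<in> space M. response_fun U \<in> X} = card X / card responses"
proof -
  interpret prob_space M by (rule prob_space_M)
  define P where "P b = {U \<in> space M. response_fun U = b}" for b
  obtain b0 where b0: "b0 \<in> responses" using response_fun_in_responses by blast
  have sum: "measure M {U \<in> space M. response_fun U \<in> Y} = card Y * measure M (P b0)"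
    if Y: "Y \<subseteq> responses" for Y
  proof -
    have "{U \<in> space M. response_fun U \<in> Y} = (\<Union>b\<in>Y. P b)" by (auto simp: P_def)
    also have "measure M \<dots> = (\<Sum>b\<in>Y. measure M (P b))"
      using finite_subset[OF Y finite_responses] Y pred_response_fun
      by (intro finite_measure_finite_Union) (auto simp: P_def disjoint_family_on_def pred_def)
    also have "\<dots> = (\<Sum>b\<in>Y. measure M (P b0))"
    proof (rule sum.cong[OF refl])
      fix b assume "b \<in> Y"
      then have "b \<in> responses" using Y by blast
      then show "measure M (P b) = measure M (P b0)"
        unfolding P_def using b0 by (intro antisym measure_response_fun_le)
    qed
    finally show ?thesis by simp
  qed
  have "{U \<in> space M. response_fun U \<in> responses} = space M"
    using response_fun_in_responses by auto
  then have "card responses * measure M (P b0) = 1"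
    using sum[OF order_refl] prob_space by simp
  then show ?thesis
    unfolding sum[OF X] using card_responses_pos by (simp add: field_simps)
qed

section \<open>Hitting probabilities from a fixed and from a uniform start\<close>

lemma measure_hitting_time_le:
  assumes "a \<in> profiles n m"
  shows "measure M {U \<in> space M. hitting_time n m U a \<le> enat t}
    = card {b \<in> responses. \<exists>s\<in>{1..t}. nash b (state b a s)} / card responses"
proof -
  let ?X = "{b \<in> responses. \<exists>s\<in>{1..t}. nash b (state b a s)}"
  have eq: "{U \<in> space M. hitting_time n m U a \<le> enat t} = {U \<in> space M. response_fun U \<in> ?X}"
    unfolding hitting_time_le_iff_nash[OF assms] using response_fun_in_responses by blast
  show ?thesis unfolding eq by (rule measure_response_fun_in) blast
qed

text \<open>Moves never touch coordinates outside \<open>{..<n}\<close>. Hence the starts from which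
  an equilibrium can be hit lie in a countable set, although the space of starts contains all
  functions.\<close>

lemma extensional_clockworkD:
  "clockwork n m U a t \<in> extensional {..<n} \<Longrightarrow> a \<in> extensional {..<n}"
proof (induction t)
  case (Suc t)
  have "clockwork n m U a t x = undefined" if "x \<notin> {..<n}" for x
  proof -
    have "x \<noteq> t mod n" using that n_pos by auto
    then show ?thesis using extensional_arb[OF Suc.prems that] by (simp add: Let_def)
  qed
  then show ?case by (intro Suc.IH) (simp add: extensional_def)
qed simp

lemma profiles_nonempty: "profiles n m \<noteq> {}"
proof -
  have "{..<m i} \<noteq> {}" if "i < n" for i using m_pos[OF that] by auto
  then show ?thesis unfolding profiles_def PiE_eq_empty_iff by blast
qed

lemma measure_game_space_hitting_time:
  "measure (game_space n m D)
     {\<omega> \<in> space (game_space n m D). hitting_time n m (fst \<omega>) (snd \<omega>) \<le> enat t}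
   = (\<Sum>a\<in>profiles n m. measure M {U \<in> space M. hitting_time n m U a \<le> enat t}) / card (profiles n m)"
proof -
  let ?P = "measure_pmf (pmf_of_set (profiles n m))"
  interpret M: prob_space M by (rule prob_space_M)
  interpret pair_prob_space M ?P ..
  let ?S = "{\<omega> \<in> space (game_space n m D). hitting_time n m (fst \<omega>) (snd \<omega>) \<le> enat t}"
  let ?H = "\<lambda>a. {U \<in> space M. hitting_time n m U a \<le> enat t}"
  have H: "?H a \<in> sets M" for a using pred_hitting_time by (simp add: pred_def)
  \<comment> \<open>Measurability in the product space follows from writing the event as a countable
    union of rectangles, one for each extensional start.\<close>
  have "?S = (\<Union>a\<in>PiE {..<n} (\<lambda>_. UNIV). ?H a \<times> {a})"
  proof -
    have "a \<in> extensional {..<n}" if "hitting_time n m U a \<le> enat t" for U a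
      using that extensional_clockworkD
      by (force simp: hitting_time_le_iff is_PNE_def profiles_def PiE_def)
    then show ?thesis
      by (auto simp: game_space_def space_pair_measure PiE_def)
  qed
  also have "\<dots> \<in> sets (M \<Otimes>\<^sub>M ?P)"
    using H by (intro sets.countable_UN' countable_PiE pair_measureI) auto
  finally have S: "?S \<in> sets (M \<Otimes>\<^sub>M ?P)" .
  have "emeasure (game_space n m D) ?S = (\<integral>\<^sup>+a. emeasure M ((\<lambda>U. (U, a)) -` ?S) \<partial>?P)"
    unfolding game_space_def by (rule emeasure_pair_measure_alt2) (use S in \<open>simp add: game_space_def\<close>)
  also have "\<dots> = (\<integral>\<^sup>+a. ennreal (measure M (?H a)) \<partial>?P)"
  proof (rule nn_integral_cong)
    fix a
    have "(\<lambda>U. (U, a)) -` ?S = ?H a" by (auto simp: game_space_def space_pair_measure)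
    then show "emeasure M ((\<lambda>U. (U, a)) -` ?S) = ennreal (measure M (?H a))"
      by (simp add: M.emeasure_eq_measure)
  qed
  also have "\<dots> = ennreal ((\<Sum>a\<in>profiles n m. measure M (?H a)) / card (profiles n m))"
    using finite_profiles profiles_nonempty
    by (simp add: nn_integral_pmf_of_set sum_ennreal ennreal_of_nat_eq_real_of_nat divide_ennreal
        card_gt_0_iff sum_nonneg)
  finally show ?thesis
    by (simp add: measure_def sum_nonneg)
qed

end

section \<open>Both bounds for the uniform starting profile\<close>

theorem lemma2:
  fixes n :: nat and m :: "nat \<Rightarrow> nat" and D :: "real measure" and t :: nat
  assumes "n \<ge> 2"
    and "\<forall>i<n. m i \<ge> 2"
    and "prob_space D"
    and "sets D = sets borel"
    and "\<forall>x. measure D {x} = 0"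
  shows "real (t div n) * (1 / q_nm n m)
           * (1 - (of_int \<lceil>real t / real n\<rceil>)\<^sup>2 / 2 * (real n / q_nm n m))
         \<le> measure (game_space n m D)
             {\<omega> \<in> space (game_space n m D). hitting_time n m (fst \<omega>) (snd \<omega>) \<le> enat t}
       \<and> measure (game_space n m D)
             {\<omega> \<in> space (game_space n m D). hitting_time n m (fst \<omega>) (snd \<omega>) \<le> enat t}
         \<le> real t / q_nm n m"
proof -
  interpret random_clockwork_game n m D
  proof (intro random_clockwork_game.intro clockwork_game.intro random_clockwork_game_axioms.intro)
    show "0 < n" using assms(1) by linarith
    show "0 < m i" if "i < n" for i using assms(2)[rule_format, OF that] by linarith
    show "measure D {x} = 0" for x using assms(5) by (rule spec)
  qed (fact assms)+
  have "Max (m ` {..<n}) \<in> m ` {..<n}" using n_pos by (intro Max_in) auto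
  then obtain i where i: "i < n" "m i = Max (m ` {..<n})" by auto
  have max: "m k \<le> m i" if "k < n" for k using that i by simp
  \<comment> \<open>Dropping a player with the most actions from the product amounts to dividing by
    the maximum, so this is \<open>q_nm n m\<close>.\<close>
  define q where "q = (\<Prod>k\<in>{..<n} - {i}. m k)"
  have q_pos: "q > 0" unfolding q_def using m_pos by (intro prod_pos) auto
  have q: "q_nm n m = real q"
    using i m_pos[OF i(1)] prod.remove[of "{..<n}" i m] by (simp add: q_nm_def q_def)
  let ?N = "real (card responses)"
  let ?h = "\<lambda>a. measure M {U \<in> space M. hitting_time n m U a \<le> enat t}"
  let ?L = "real (t div n) * (1 / q) * (1 - (of_int \<lceil>real t / real n\<rceil>)\<^sup>2 / 2 * (real n / q))"
  have N: "?N > 0" using card_responses_pos by simp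
  have upper: "?h a \<le> t / q" if a: "a \<in> profiles n m" for a
  proof -
    let ?c = "card {b \<in> responses. \<exists>s\<in>{1..t}. nash b (state b a s)}"
    have "real (?c * q) \<le> real (t * card responses)"
      using card_hits_le[OF a i(1) max, of t] unfolding q_def of_nat_le_iff by simp
    then show ?thesis
      unfolding measure_hitting_time_le[OF a] using N q_pos by (simp add: field_simps)
  qed
  have lower: "?L \<le> ?h a" if a: "a \<in> profiles n m" for a
  proof -
    let ?k = "t div n"
    let ?c = "\<lambda>t. card {b \<in> responses. \<exists>s\<in>{1..t}. nash b (state b a s)}"
    have "real ?k \<le> real t / real n" by (rule of_nat_div_le_of_nat)
    also have "\<dots> \<le> of_int \<lceil>real t / real n\<rceil>" by (rule le_of_int_ceiling)
    finally have "(real ?k)\<^sup>2 \<le> (of_int \<lceil>real t / real n\<rceil>)\<^sup>2" by (intro power_mono) auto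
    \<comment> \<open>The round count is at most the ceiling, so the subtracted square in
      \<open>?L\<close> is the larger one.\<close>
    then have "?L \<le> real ?k * (1 / q) * (1 - (real ?k)\<^sup>2 / 2 * (real n / q))"
      by (intro mult_left_mono diff_left_mono mult_right_mono divide_right_mono) auto
    moreover have "real ?k * (1 / q) * (1 - (real ?k)\<^sup>2 / 2 * (real n / q)) * ?N \<le> ?c (?k * n)"
      using card_hits_ge[OF a i(1) max, of ?k] unfolding q_def by simp
    \<comment> \<open>Hits in the complete rounds are also hits by time \<open>t\<close>.\<close>
    moreover have "?c (?k * n) \<le> ?c t"
    proof (rule card_mono)
      have "?k * n \<le> t" by simp
      then have "{1..?k * n} \<subseteq> {1..t}" by auto
      then show "{b \<in> responses. \<exists>s\<in>{1..?k * n}. nash b (state b a s)}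
          \<subseteq> {b \<in> responses. \<exists>s\<in>{1..t}. nash b (state b a s)}" by blast
    qed (simp add: finite_responses)
    ultimately have "?L * ?N \<le> ?c t"
      using N by (smt (verit) mult_right_mono of_nat_le_iff)
    then show ?thesis
      unfolding measure_hitting_time_le[OF a] using N by (simp add: pos_le_divide_eq)
  qed
  have card: "real (card (profiles n m)) > 0"
    using finite_profiles profiles_nonempty by (simp add: card_gt_0_iff)
  show ?thesis
    unfolding measure_game_space_hitting_time q
    using sum_bounded_below[of "profiles n m" ?L ?h, OF lower]
      sum_bounded_above[of "profiles n m" ?h "t / q", OF upper] card
    by (simp add: pos_le_divide_eq pos_divide_le_eq mult.commute)
qed

end
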